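(* Let $n\ge3$ be odd. There is a statistics-preserving bijection $$\Phi:\operatorname{Deo}^{\max}_{f_{2,n}}\to\operatorname{Dyck}_{2,n},$$ that is, a bijection with $\mathtt{area}(\Phi(D))=\mathtt{area}(D)$ and $\mathtt{dinv}(\Phi(D))=\mathtt{dinv}(D)$ for all $D$. Moreover, rotation by $180^\circ$ is a statistics-reversing bijection $\mathbf{rot}:\operatorname{Deo}^{\max}_{f_{2,n}}\to\operatorname{Deo}^{\max}_{f_{2,n}}$, that is, $(\mathtt{area}(D),\mathtt{dinv}(D))=(\mathtt{dinv}(\mathbf{rot}(D)),\mathtt{area}(\mathbf{rot}(D)))$ for all $D$.
   Context: $f_{2,n}$ is the bounded affine permutation $i\mapsto i+2$. The set $\operatorname{Deo}^{\max}_{f_{2,n}}$ of maximal $f_{2,n}$-Deograms consists of the fillings $D$ of the boxes of a rectangle with $2$ rows and $n-2$ columns by crossings and elbows satisfying the following. Label the unit edges of the northwest boundary by $1,\dots,n$ (left side from bottom to top: $1,2$; then top side from left to right: $3,\dots,n$), and those of the southeast boundary by $1,\dots,n$ (bottom side from left to right: $1,\dots,n-2$; then right side from bottom to top: $n-1,n$). Strands enter at the northwest boundary and travel right/down: in a crossing, left goes to right and top goes to bottom; in an elbow, a strand entering from the left exits at the bottom and one entering from the top exits right. The conditions are: (1) the strand entering at $i$ exits at $i$ for all $i\in[n]$; (2) (distinguished) whenever two strands form an elbow in a box, they have crossed an even number of times before it (counting from the northwest boundary); (3) $D$ has exactly $n-1$ elbows. Each $D\in\operatorname{Deo}^{\max}_{f_{2,n}}$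 has a unique column, denoted $\operatorname{col}(D)$, both of whose boxes are elbows. $\mathtt{area}(D)$ is the number of elbows to the right of the top elbow of $\operatorname{col}(D)$ (in the top row), and $\mathtt{dinv}(D)$ is the number of elbows to the left of the bottom elbow of $\operatorname{col}(D)$ (in the bottom row). $\operatorname{Dyck}_{2,n}$ is the set of lattice paths with unit up and right steps from $(0,0)$ to $(n-2,2)$ that never go below the diagonal from $(0,0)$ to $(n-2,2)$. For such a path, $\mathtt{area}$ is the number of full unit boxes lying between the path and the diagonal, and $\mathtt{dinv}$ is the usual rational Dyck path statistic: the number of boxes $b$ of the rectangle lying above (northwest of) the path such that $\frac{\mathrm{arm}(b)}{\mathrm{leg}(b)+1}<\frac{n-2}{2}<\frac{\mathrm{arm}(b)+1}{\mathrm{leg}(b)}$ (the right inequality is vacuous when $\mathrm{leg}(b)=0$), where $\mathrm{arm}(b)$, $\mathrm{leg}(b)$ are the numbers of boxes above the path strictly to the right of $b$ in its row, respectively strictly below $b$ in its column. For $2$-row paths this is simply the number of boxes above the path. *)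

theory Defs
  imports Complex_Main
begin

text \<open>
  A box is a pair of a row and a column, both counted from 0, with row 0 the top row and column 0
  the leftmost one. A filling by crossings and elbows is represented by the set of its elbow boxes.
\<close>

definition boxes :: "nat \<Rightarrow> (nat \<times> nat) set" where
  "boxes n = {..<2} \<times> {..<n - 2}"

text \<open>
  Strands are named by the northwest boundary edge at which they enter. \<open>vstrand D r c\<close> is the strand
  running through the vertical edge on the left of box \<open>(r, c)\<close>, and \<open>hstrand D r c\<close> is the strand
  running through the horizontal edge on top of box \<open>(r, c)\<close>. Thus \<open>vstrand D r (Suc c)\<close> and
  \<open>hstrand D (Suc r) c\<close> are the strands leaving box \<open>(r, c)\<close> to the right and to the bottom.
\<close>

fun vstrand :: "(nat \<times> nat) set \<Rightarrow> nat \<Rightarrow> nat \<Rightarrow> nat"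
  and hstrand :: "(nat \<times> nat) set \<Rightarrow> nat \<Rightarrow> nat \<Rightarrow> nat" where
  "vstrand D r 0 = 2 - r"
| "vstrand D r (Suc c) = (if (r, c) \<in> D then hstrand D r c else vstrand D r c)"
| "hstrand D 0 c = c + 3"
| "hstrand D (Suc r) c = (if (r, c) \<in> D then vstrand D r c else hstrand D r c)"

text \<open>
  The edge below column \<open>c\<close> has southeast label \<open>c + 1\<close>, the edge on the right of row \<open>r\<close> has
  southeast label \<open>n - r\<close>.
\<close>

definition trivial_connectivity :: "nat \<Rightarrow> (nat \<times> nat) set \<Rightarrow> bool" where
  "trivial_connectivity n D \<longleftrightarrow>
     (\<forall>c<n - 2. hstrand D 2 c = c + 1) \<and> (\<forall>r<2. vstrand D r (n - 2) = n - r)"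

text \<open>
  As strands only travel right and down, two strands meeting in box \<open>(r, c)\<close> can have met before
  only in boxes weakly above and weakly to the left of it.
\<close>

definition crossings_before :: "(nat \<times> nat) set \<Rightarrow> nat \<Rightarrow> nat \<Rightarrow> (nat \<times> nat) set" where
  "crossings_before D r c =
     {(r', c'). r' \<le> r \<and> c' \<le> c \<and> (r', c') \<noteq> (r, c) \<and> (r', c') \<notin> D \<and>
        {vstrand D r' c', hstrand D r' c'} = {vstrand D r c, hstrand D r c}}"

definition distinguished :: "(nat \<times> nat) set \<Rightarrow> bool" where
  "distinguished D \<longleftrightarrow> (\<forall>(r, c)\<in>D. even (card (crossings_before D r c)))"

definition Deo_max :: "nat \<Rightarrow> (nat \<times> nat) set set" where
  "Deo_max n =
     {D. D \<subseteq> boxes n \<and> trivial_connectivity n D \<and> distinguished D \<and> card D = n - 1}"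

text \<open>A maximal Deogram has exactly one column with two elbows.\<close>

definition deo_col :: "(nat \<times> nat) set \<Rightarrow> nat" where
  "deo_col D = (THE c. (0, c) \<in> D \<and> (1, c) \<in> D)"

definition deo_area :: "(nat \<times> nat) set \<Rightarrow> nat" where
  "deo_area D = card {c. deo_col D < c \<and> (0, c) \<in> D}"

definition deo_dinv :: "(nat \<times> nat) set \<Rightarrow> nat" where
  "deo_dinv D = card {c. c < deo_col D \<and> (1, c) \<in> D}"

text \<open>The rotation by 180 degrees maps a crossing to a crossing and an elbow to an elbow.\<close>

definition rot :: "nat \<Rightarrow> (nat \<times> nat) set \<Rightarrow> (nat \<times> nat) set" where
  "rot n D = (\<lambda>(r, c). (1 - r, n - 3 - c)) ` D"

datatype step = Up | Rt

text \<open>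
  The diagonal is the line through the origin and \<open>(n - 2, 2)\<close>; a lattice point \<open>(x, y)\<close> lies on or
  above it iff \<open>2 * x \<le> (n - 2) * y\<close>. A lattice path is piecewise linear, so it never goes below the
  diagonal iff none of its lattice points does.
\<close>

definition Dyck :: "nat \<Rightarrow> step list set" where
  "Dyck n = {P. count_list P Rt = n - 2 \<and> count_list P Up = 2 \<and>
     (\<forall>t\<le>length P. 2 * count_list (take t P) Rt \<le> (n - 2) * count_list (take t P) Up)}"

text \<open>
  For Dyck paths, \<open>(i, j)\<close> stands for the unit box with lower left corner at the point \<open>(i, j)\<close>, in
  Cartesian coordinates. The box lies above (northwest of) the path iff the up step of the path from
  height \<open>j\<close> to height \<open>j + 1\<close> is to the right of the box.
\<close>

definition above_path :: "step list \<Rightarrow> (nat \<times> nat) set" where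
  "above_path P =
     {(i, j). \<exists>p s. P = p @ Up # s \<and> count_list p Up = j \<and> i < count_list p Rt}"

text \<open>
  A unit box lies above the diagonal iff its lower right corner does not lie below the diagonal.
\<close>

definition dyck_area :: "nat \<Rightarrow> step list \<Rightarrow> nat" where
  "dyck_area n P =
     card {(i, j). i < n - 2 \<and> j < 2 \<and> (i, j) \<notin> above_path P \<and> 2 * (i + 1) \<le> (n - 2) * j}"

fun arm :: "step list \<Rightarrow> nat \<times> nat \<Rightarrow> nat" where
  "arm P (i, j) = card {i'. i < i' \<and> (i', j) \<in> above_path P}"

fun leg :: "step list \<Rightarrow> nat \<times> nat \<Rightarrow> nat" where
  "leg P (i, j) = card {j'. j' < j \<and> (i, j') \<in> above_path P}"

definition dyck_dinv :: "nat \<Rightarrow> step list \<Rightarrow> nat" where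
  "dyck_dinv n P =
     card {b \<in> above_path P.
       real (arm P b) / (real (leg P b) + 1) < (real n - 2) / 2 \<and>
       (leg P b = 0 \<or> (real n - 2) / 2 < (real (arm P b) + 1) / real (leg P b))}"

end

theory Submission
  imports Defs
begin

text \<open>
  Before column \<open>c\<close> the strands on the left of rows 0 and 1 are forced to be \<open>c + 2, c + 1\<close> or
  \<open>c + 1, c + 2\<close>. In the first (descending) state the bottom box is an elbow, and the top box decides
  whether the state is kept; in the second one the column has a top elbow only and the state
  switches back. So the double elbows are exactly the columns that keep the descending state, and
  as there is only one of them, its position \<open>2 * a\<close> determines the whole filling. All these fillings
  are distinguished, because the two strands of an elbow have never crossed before. On the other
  side, a Dyck path with two up steps is determined by the number \<open>a\<close> of right steps between them.
\<close>

section \<open>Strands of trivially connected fillings\<close>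

definition descending :: "(nat \<times> nat) set \<Rightarrow> nat \<Rightarrow> bool" where
  "descending D c \<longleftrightarrow> vstrand D 0 c = c + 2 \<and> vstrand D 1 c = c + 1"

definition ascending :: "(nat \<times> nat) set \<Rightarrow> nat \<Rightarrow> bool" where
  "ascending D c \<longleftrightarrow> vstrand D 0 c = c + 1 \<and> vstrand D 1 c = c + 2"

text \<open>Strands never move left, so one found in column \<open>c\<close> entered on the left
  side or on top of a column not to the right of \<open>c\<close>. This limits where two given
  strands can have met earlier.\<close>

lemma strand_le:
  shows "vstrand D r c \<le> c + 2" and "hstrand D r c \<le> c + 3"
  by (induction D r c and D r c rule: vstrand_hstrand.induct) auto

lemma descending_0: "descending D 0"
  by (simp add: descending_def)

lemma not_ascending_if_descending: "descending D c \<Longrightarrow> \<not> ascending D c"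
  by (simp add: descending_def ascending_def)

lemma hstrand_2: "hstrand D 2 c = (if (1, c) \<in> D then vstrand D 1 c else hstrand D 1 c)"
  by (simp add: numeral_2_eq_2)

text \<open>Strand \<open>c + 1\<close> must leave below column \<open>c\<close>. It arrives in the
  bottom row, so only a bottom elbow sends it down; the top box then decides which of
  \<open>c + 2\<close> and \<open>c + 3\<close> continues in the top row.\<close>

lemma descending_step:
  assumes "descending D c"
  shows "hstrand D 2 c = c + 1 \<longleftrightarrow> (1, c) \<in> D"
    and "(1, c) \<in> D \<Longrightarrow> (0, c) \<in> D \<Longrightarrow> descending D (Suc c)"
    and "(1, c) \<in> D \<Longrightarrow> (0, c) \<notin> D \<Longrightarrow> ascending D (Suc c)"
  using assms by (auto simp: descending_def ascending_def hstrand_2)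

text \<open>Now \<open>c + 1\<close> arrives in the top row: it has to turn down there and pass
  straight through the bottom box, and this crossing with \<open>c + 2\<close> restores the
  order.\<close>

lemma ascending_step:
  assumes "ascending D c"
  shows "hstrand D 2 c = c + 1 \<longleftrightarrow> (1, c) \<notin> D \<and> (0, c) \<in> D"
    and "(1, c) \<notin> D \<Longrightarrow> (0, c) \<in> D \<Longrightarrow> descending D (Suc c)"
  using assms by (auto simp: descending_def ascending_def hstrand_2)

lemma descending_or_ascending:
  assumes "trivial_connectivity n D" and "c \<le> n - 2"
  shows "descending D c \<or> ascending D c"
  using assms(2)
proof (induction c)
  case 0
  then show ?case by (simp add: descending_0)
next
  case (Suc c)
  then have "hstrand D 2 c = c + 1"
    using assms(1) by (simp add: trivial_connectivity_def)
  with Suc descending_step[of D c] ascending_step[of D c] show ?case by auto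
qed

text \<open>Both boxes of a column can be read off from the states before and after it, so a
  trivially connected filling amounts to the Boolean sequence \<open>descending D c\<close>, in
  which the ascending state is never repeated.\<close>

lemma trivial_connectivity_column:
  assumes "trivial_connectivity n D" and "c < n - 2"
  shows "(1, c) \<in> D \<longleftrightarrow> descending D c"
    and "(0, c) \<in> D \<longleftrightarrow> (descending D c \<longrightarrow> descending D (Suc c))"
    and "\<not> descending D c \<Longrightarrow> descending D (Suc c)"
proof -
  have h: "hstrand D 2 c = c + 1"
    using assms by (simp add: trivial_connectivity_def)
  have s: "descending D c \<or> ascending D c"
    using assms by (intro descending_or_ascending) auto
  show "(1, c) \<in> D \<longleftrightarrow> descending D c"
    using s h descending_step(1) ascending_step(1) not_ascending_if_descending by blast
  show "(0, c) \<in> D \<longleftrightarrow> (descending D c \<longrightarrow> descending D (Suc c))"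
    using s h descending_step ascending_step not_ascending_if_descending by metis
  show "\<not> descending D c \<Longrightarrow> descending D (Suc c)"
    using s h ascending_step by blast
qed

text \<open>A strand entering on top of a column meets others only from that column on. This pins an
  earlier crossing to the same column or the one before, and the states exclude both.\<close>

lemma distinguished_if_trivial_connectivity:
  assumes "trivial_connectivity n D" and "D \<subseteq> boxes n"
  shows "distinguished D"
proof -
  have "crossings_before D r c = {}" if rc: "(r, c) \<in> D" for r c
  proof (rule ccontr)
    assume "crossings_before D r c \<noteq> {}"
    then obtain r' c' where before: "r' \<le> r" "c' \<le> c" "(r', c') \<noteq> (r, c)" "(r', c') \<notin> D"
      and eq: "{vstrand D r' c', hstrand D r' c'} = {vstrand D r c, hstrand D r c}"
      by (auto simp: crossings_before_def)
    have c: "c < n - 2" and r: "r = 0 \<or> r = 1"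
      using rc assms(2) by (auto simp: boxes_def)
    have le: "vstrand D r' c' \<le> c' + 2" "hstrand D r' c' \<le> c' + 3"
      by (rule strand_le)+
    have cases: "descending D c \<or> ascending D c"
      using assms c by (intro descending_or_ascending) auto
    show False
    proof (cases "hstrand D r c = c + 3")
      case True
      with eq le have "c' = c"
        using before(2) by (auto simp: doubleton_eq_iff)
      with before r have "r' = 0" "r = 1" by auto
      then show False
        using eq \<open>c' = c\<close> cases True
        by (auto simp: descending_def ascending_def doubleton_eq_iff)
    next
      case False
      \<comment> \<open>What is left is a bottom box below a top elbow; there the two strands that
        entered the column from the left meet again.\<close>
      with r have r1: "r = 1" and top: "(0, c) \<in> D" by (auto split: if_splits)
      with rc have desc: "descending D c"
        using trivial_connectivity_column(1)[OF assms(1) c] by simp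
      then have pair: "{vstrand D r' c', hstrand D r' c'} = {c + 1, c + 2}"
        using eq r1 top by (auto simp: descending_def)
      have "r' = 0 \<or> r' = 1" using before(1) r1 by auto
      with before top r1 have "c' < c"
        by (metis le_neq_implies_less)
      \<comment> \<open>Strand \<open>c + 2\<close> enters on top of column \<open>c - 1\<close>, so
        the earlier crossing must lie in that column.\<close>
      with pair le have c': "c = Suc c'" and h: "hstrand D r' c' = c' + 3"
        by (auto simp: doubleton_eq_iff)
      \<comment> \<open>Either this box is the crossing itself, or \<open>c' + 3\<close> came
        straight down through it. A top crossing in column \<open>c'\<close> contradicts the
        descending state at \<open>c\<close>.\<close>
      have "(0, c') \<notin> D"
        using \<open>r' = 0 \<or> r' = 1\<close> before(4) h strand_le(1)[of D 0 c'] by auto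
      moreover have "c' < n - 2" using c c' by simp
      ultimately show False
        using trivial_connectivity_column(2)[OF assms(1)] desc c' by blast
    qed
  qed
  then show ?thesis by (auto simp: distinguished_def)
qed

section \<open>Classification of the maximal Deograms\<close>

text \<open>Here \<open>n = 2 * k + 3\<close>. On each side of the double elbow the single elbows
  read bottom, top, bottom, top, and so on.\<close>

definition deogram :: "nat \<Rightarrow> nat \<Rightarrow> (nat \<times> nat) set" where
  "deogram k a = {(r, c). r < 2 \<and> c < 2 * k + 1 \<and>
     (c = 2 * a \<or> (c < 2 * a \<and> (r = 1 \<longleftrightarrow> even c)) \<or> (2 * a < c \<and> (r = 1 \<longleftrightarrow> odd c)))}"

text \<open>With \<open>n - 2\<close> columns, none of them without elbow, having
  \<open>n - 1\<close> elbows amounts to having exactly one double elbow.\<close>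

lemma card_by_columns:
  fixes D :: "(nat \<times> nat) set"
  assumes "D \<subseteq> {..<2} \<times> {..<m}"
    and "\<And>c. c < m \<Longrightarrow> (0, c) \<in> D \<or> (1, c) \<in> D"
  shows "card D = m + card {c. (0, c) \<in> D \<and> (1, c) \<in> D}"
proof -
  let ?T = "{c. (0, c) \<in> D}" and ?B = "{c. (1, c) \<in> D}"
  have "r = 0 \<or> r = 1" if "(r, c) \<in> D" for r c
    using assms(1) that by (auto simp: less_2_cases_iff)
  then have D: "D = Pair 0 ` ?T \<union> Pair 1 ` ?B"
    by fast
  have cover: "?T \<union> ?B = {..<m}"
    using assms by auto
  have fin: "finite ?T" "finite ?B"
    using cover finite_Un[of ?T ?B] by simp_all
  have "card D = card (Pair (0::nat) ` ?T \<union> Pair (1::nat) ` ?B)"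
    using D by (rule arg_cong)
  also have "\<dots> = card (Pair (0::nat) ` ?T) + card (Pair (1::nat) ` ?B)"
    by (rule card_Un_disjoint) (use fin in auto)
  also have "\<dots> = card ?T + card ?B"
    by (simp add: card_image inj_on_def)
  also have "\<dots> = card (?T \<union> ?B) + card (?T \<inter> ?B)"
    using fin by (rule card_Un_Int)
  finally show ?thesis
    unfolding cover by (simp add: Int_def)
qed

lemma deogram_subset_boxes: "deogram k a \<subseteq> boxes (2 * k + 3)"
  by (auto simp: deogram_def boxes_def)

text \<open>The states alternate, except that column \<open>2 * a\<close> keeps the descending one;
  hence the parity test is reversed beyond \<open>2 * a\<close>.\<close>

lemma deogram_state:
  assumes "a \<le> k" and "c \<le> 2 * k + 1"
  shows "if even c \<longleftrightarrow> c \<le> 2 * a then descending (deogram k a) c else ascending (deogram k a) c"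
  using assms(2)
proof (induction c)
  case 0
  then show ?case by (simp add: descending_0)
next
  case (Suc c)
  show ?case
  proof (cases "even c \<longleftrightarrow> c \<le> 2 * a")
    case True
    with Suc have d: "descending (deogram k a) c" by simp
    have "(1, c) \<in> deogram k a"
      using True Suc.prems by (auto simp: deogram_def)
    moreover have "(0, c) \<in> deogram k a \<longleftrightarrow> c = 2 * a"
      using True Suc.prems by (auto simp: deogram_def)
    ultimately show ?thesis
      using True descending_step(2,3)[OF d] by (auto simp: le_less Suc_le_eq)
  next
    case False
    with Suc have d: "ascending (deogram k a) c" by simp
    have "(1, c) \<notin> deogram k a" "(0, c) \<in> deogram k a"
      using False Suc.prems by (auto simp: deogram_def)
    with False show ?thesis
      using ascending_step(2)[OF d] by (auto simp: le_less Suc_le_eq)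
  qed
qed

lemma trivial_connectivity_deogram:
  assumes "a \<le> k"
  shows "trivial_connectivity (2 * k + 3) (deogram k a)"
  unfolding trivial_connectivity_def
proof (intro conjI allI impI)
  fix c assume "c < 2 * k + 3 - 2"
  then have c: "c < 2 * k + 1" by simp
  show "hstrand (deogram k a) 2 c = c + 1"
  proof (cases "even c \<longleftrightarrow> c \<le> 2 * a")
    case True
    then have "descending (deogram k a) c"
      using deogram_state[OF assms, of c] c by simp
    then show ?thesis
      using True c descending_step(1) by (auto simp: deogram_def)
  next
    case False
    then have "ascending (deogram k a) c"
      using deogram_state[OF assms, of c] c by simp
    then show ?thesis
      using False c ascending_step(1) by (auto simp: deogram_def)
  qed
next
  fix r :: nat assume "r < 2"
  \<comment> \<open>The final index is odd and exceeds \<open>2 * a\<close>, so the last state is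
    descending, which is the order required of the exits on the right side.\<close>
  moreover have "descending (deogram k a) (2 * k + 1)"
    using deogram_state[OF assms, of "2 * k + 1"] assms by auto
  ultimately show "vstrand (deogram k a) r (2 * k + 3 - 2) = 2 * k + 3 - r"
    by (auto simp: descending_def less_2_cases_iff)
qed

lemma double_elbow_deogram_iff:
  assumes "a \<le> k"
  shows "(0, c) \<in> deogram k a \<and> (1, c) \<in> deogram k a \<longleftrightarrow> c = 2 * a"
  using assms by (auto simp: deogram_def)

lemma deogram_in_Deo_max:
  assumes "a \<le> k"
  shows "deogram k a \<in> Deo_max (2 * k + 3)"
proof -
  have "card (deogram k a) = 2 * k + 1 + card {c. (0, c) \<in> deogram k a \<and> (1, c) \<in> deogram k a}"
    by (rule card_by_columns) (auto simp: deogram_def)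
  also have "\<dots> = 2 * k + 2"
    unfolding double_elbow_deogram_iff[OF assms] by simp
  finally show ?thesis
    using distinguished_if_trivial_connectivity[OF trivial_connectivity_deogram[OF assms]
        deogram_subset_boxes]
    by (simp add: Deo_max_def deogram_subset_boxes trivial_connectivity_deogram assms)
qed

lemma Deo_max_cases:
  assumes "D \<in> Deo_max (2 * k + 3)"
  obtains a where "a \<le> k" and "D = deogram k a"
proof -
  have sub: "D \<subseteq> {..<2} \<times> {..<2 * k + 1}" and tc: "trivial_connectivity (2 * k + 3) D"
    and card: "card D = 2 * k + 2"
    using assms by (auto simp: Deo_max_def boxes_def)
  have bottom: "(1, c) \<in> D \<longleftrightarrow> descending D c"
    and top: "(0, c) \<in> D \<longleftrightarrow> (descending D c \<longrightarrow> descending D (Suc c))"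
    and up: "\<not> descending D c \<Longrightarrow> descending D (Suc c)" if "c < 2 * k + 1" for c
    using trivial_connectivity_column[OF tc, of c] that by auto
  have "card D = 2 * k + 1 + card {c. (0, c) \<in> D \<and> (1, c) \<in> D}"
    by (rule card_by_columns[OF sub]) (use bottom top in auto)
  with card obtain d where d: "{c. (0, c) \<in> D \<and> (1, c) \<in> D} = {d}"
    by (auto simp: card_1_singleton_iff)
  then have dd: "(0, d) \<in> D" "(1, d) \<in> D" by auto
  with sub have dk: "d < 2 * k + 1" by auto
  \<comment> \<open>A column that keeps the descending state has two elbows, and the ascending state
    is never kept, so only \<open>d\<close> avoids a flip.\<close>
  have flip: "descending D (Suc c) \<longleftrightarrow> \<not> descending D c" if "c < 2 * k + 1" "c \<noteq> d" for c
    using bottom[of c] top[of c] up[of c] d that by auto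
  have before: "descending D c \<longleftrightarrow> even c" if "c \<le> d" for c
    using that dk by (induction c) (auto simp: descending_0 flip)
  \<comment> \<open>The bottom elbow makes the state at \<open>d\<close> descending, and up to
    \<open>d\<close> this happens at even columns only; so \<open>d\<close> is even.\<close>
  have "descending D d" "descending D (Suc d)"
    using bottom[OF dk] top[OF dk] dd by auto
  with before obtain a where a: "d = 2 * a" by (auto elim: evenE)
  have after: "descending D c \<longleftrightarrow> odd c" if "Suc d \<le> c" "c \<le> 2 * k + 1" for c
    using that
  proof (induction c rule: dec_induct)
    case base
    then show ?case using \<open>descending D (Suc d)\<close> a by simp
  next
    case (step c)
    then show ?case using flip[of c] by simp
  qed
  have "(r, c) \<in> D \<longleftrightarrow> (r, c) \<in> deogram k a" for r c
  proof (cases "r < 2 \<and> c < 2 * k + 1")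
    case True
    then have c: "c < 2 * k + 1" and r: "r = 0 \<or> r = 1" by auto
    consider "c < d" | "c = d" | "d < c" by linarith
    then show ?thesis
    proof cases
      case 1
      then show ?thesis
        using r bottom[OF c] top[OF c] before[of c] flip[OF c] c a by (auto simp: deogram_def)
    next
      case 2
      then show ?thesis using r c a dd by (auto simp: deogram_def)
    next
      case 3
      then show ?thesis
        using r bottom[OF c] top[OF c] after[of c] flip[OF c] c a by (auto simp: deogram_def)
    qed
  qed (use sub in \<open>auto simp: deogram_def\<close>)
  then have "D = deogram k a" by auto
  moreover have "a \<le> k" using dk a by simp
  ultimately show thesis using that by blast
qed

lemma deo_col_deogram: "a \<le> k \<Longrightarrow> deo_col (deogram k a) = 2 * a"
  unfolding deo_col_def double_elbow_deogram_iff by simp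

lemma bij_betw_deogram: "bij_betw (deogram k) {..k} (Deo_max (2 * k + 3))"
proof (rule bij_betw_imageI)
  show "inj_on (deogram k) {..k}"
    by (rule inj_on_inverseI[where g = "\<lambda>D. deo_col D div 2"]) (simp add: deo_col_deogram)
  show "deogram k ` {..k} = Deo_max (2 * k + 3)"
    by (auto simp: deogram_in_Deo_max elim: Deo_max_cases)
qed

text \<open>The top elbows beyond the double elbow sit in even columns, and so do the bottom elbows
  before it; both statistics thus count even columns.\<close>

lemma deo_area_deogram:
  assumes "a \<le> k"
  shows "deo_area (deogram k a) = k - a"
proof -
  have "{c. 2 * a < c \<and> (0, c) \<in> deogram k a} = (*) 2 ` {a<..k}"
    by (auto simp: deogram_def elim!: evenE)
  then show ?thesis
    by (simp add: deo_area_def deo_col_deogram assms card_image inj_on_def)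
qed

lemma deo_dinv_deogram:
  assumes "a \<le> k"
  shows "deo_dinv (deogram k a) = a"
proof -
  have "{c. c < 2 * a \<and> (1, c) \<in> deogram k a} = (*) 2 ` {..<a}"
    using assms by (auto simp: deogram_def elim!: evenE)
  then show ?thesis
    by (simp add: deo_dinv_def deo_col_deogram assms card_image inj_on_def)
qed

text \<open>The reflection of \<open>c\<close> to \<open>2 * k - c\<close> preserves parity and
  swaps the two sides of the double elbow, while the rows are exchanged; so the two alternating
  clauses of \<open>deogram\<close> trade places.\<close>

lemma rot_deogram:
  assumes "a \<le> k"
  shows "rot (2 * k + 3) (deogram k a) = deogram k (k - a)"
proof -
  \<comment> \<open>One inclusion for arbitrary \<open>b\<close> suffices: applied to
    \<open>k - a\<close> it yields preimages for the other inclusion.\<close>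
  have imp: "(1 - r, 2 * k - c) \<in> deogram k (k - b)" if "b \<le> k" "(r, c) \<in> deogram k b" for r c b
  proof -
    have "c \<le> 2 * k" "r = 0 \<or> r = 1"
      using that(2) by (auto simp: deogram_def)
    moreover from \<open>c \<le> 2 * k\<close> have "even (2 * k - c) \<longleftrightarrow> even c"
      by simp
    ultimately show ?thesis
      using that by (auto simp: deogram_def)
  qed
  show ?thesis
  proof
    show "rot (2 * k + 3) (deogram k a) \<subseteq> deogram k (k - a)"
      using imp[OF assms] by (auto simp: rot_def)
    show "deogram k (k - a) \<subseteq> rot (2 * k + 3) (deogram k a)"
    proof
      fix x assume x: "x \<in> deogram k (k - a)"
      obtain r c where rc: "x = (r, c)" by fastforce
      have "(1 - r, 2 * k - c) \<in> deogram k a"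
        using imp[of "k - a" r c] x rc assms by simp
      moreover have "(r, c) = (1 - (1 - r), 2 * k - (2 * k - c))"
        using x rc by (auto simp: deogram_def)
      ultimately show "x \<in> rot (2 * k + 3) (deogram k a)"
        unfolding rot_def rc by (force intro: rev_image_eqI)
    qed
  qed
qed

section \<open>Dyck paths with two up steps\<close>

definition dyck_path :: "nat \<Rightarrow> nat \<Rightarrow> step list" where
  "dyck_path k a = Up # replicate a Rt @ Up # replicate (2 * k + 1 - a) Rt"

lemma count_list_replicate: "count_list (replicate a x) y = (if x = y then a else 0)"
  by (induction a) auto

lemma replicate_Rt_if_count_Up_0: "count_list xs Up = 0 \<Longrightarrow> xs = replicate (length xs) Rt"
proof (induction xs)
  case (Cons s xs)
  then show ?case by (cases s) auto
qed simp

lemma dyck_path_in_Dyck: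
  assumes "a \<le> k"
  shows "dyck_path k a \<in> Dyck (2 * k + 3)"
proof -
  have "2 * count_list (take t (dyck_path k a)) Rt
      \<le> (2 * k + 1) * count_list (take t (dyck_path k a)) Up" for t
  \<comment> \<open>Before the second up step there are at most \<open>a \<le> k\<close> right steps
    at height 1; after it the height is 2 and the bound is twice the total number of right
    steps.\<close>
  proof (cases "t \<le> Suc a")
    case True
    then show ?thesis
      using assms by (cases t) (auto simp: dyck_path_def count_list_replicate)
  next
    case False
    then obtain s where s: "t = Suc (Suc (a + s))"
      by (metis add_Suc less_iff_Suc_add not_le)
    have "count_list (take t (dyck_path k a)) Up = 2"
      by (simp add: s dyck_path_def count_list_replicate)
    moreover have "count_list (take t (dyck_path k a)) Rt \<le> 2 * k + 1"
      using assms by (simp add: s dyck_path_def count_list_replicate)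
    ultimately show ?thesis by simp
  qed
  then show ?thesis
    using assms by (auto simp: Dyck_def dyck_path_def count_list_replicate)
qed

lemma Dyck_cases:
  assumes "P \<in> Dyck (2 * k + 3)"
  obtains a where "a \<le> k" and "P = dyck_path k a"
proof -
  have R: "count_list P Rt = 2 * k + 1" and U: "count_list P Up = 2"
    and le: "\<And>t. t \<le> length P \<Longrightarrow>
      2 * count_list (take t P) Rt \<le> (2 * k + 1) * count_list (take t P) Up"
    using assms by (auto simp: Dyck_def)
  obtain s Q where P: "P = s # Q"
    using U by (cases P) auto
  \<comment> \<open>An initial right step would leave the point \<open>(1, 0)\<close> below the
    diagonal.\<close>
  with le[of 1] have s: "s = Up" by (cases s) auto
  with U P have QU: "count_list Q Up = 1" by simp
  then have "Up \<in> set Q" by (metis count_notin zero_neq_one)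
  then obtain xs ys where Q: "Q = xs @ Up # ys"
    by (meson split_list)
  with QU have xs: "xs = replicate (length xs) Rt" and ys: "ys = replicate (length ys) Rt"
    by (auto intro: replicate_Rt_if_count_Up_0)
  have cxs: "count_list xs Rt = length xs" "count_list ys Rt = length ys" "count_list xs Up = 0"
    using xs ys by (metis count_list_replicate step.distinct(1))+
  \<comment> \<open>The prefix ending just before the second up step gives the sharpest bound, and
    parity improves it to \<open>length xs \<le> k\<close>.\<close>
  have "2 * length xs \<le> 2 * k + 1"
    using le[of "Suc (length xs)"] P Q s cxs by simp
  then have "length xs \<le> k" by simp
  moreover have "length ys = 2 * k + 1 - length xs"
    using R P Q s cxs by simp
  then have "P = dyck_path k (length xs)"
    unfolding dyck_path_def P s Q using xs ys by simp
  ultimately show thesis using that by blast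
qed

lemma above_path_dyck_path: "above_path (dyck_path k a) = {..<a} \<times> {1}"
proof -
  have "(i, j) \<in> above_path (dyck_path k a) \<longleftrightarrow> i < a \<and> j = 1" for i j
  proof
    assume "(i, j) \<in> above_path (dyck_path k a)"
    then obtain p s where ps: "dyck_path k a = p @ Up # s" and j: "count_list p Up = j"
      and i: "i < count_list p Rt"
      by (auto simp: above_path_def)
    \<comment> \<open>A box needs a right step before its up step, so \<open>p\<close> is not empty
      and the up step in question is the second one.\<close>
    from i obtain q where p: "p = Up # q"
      using ps by (cases p) (auto simp: dyck_path_def)
    with ps have eq: "replicate a Rt @ Up # replicate (2 * k + 1 - a) Rt = q @ Up # s"
      by (simp add: dyck_path_def)
    have "Up \<notin> set (replicate a Rt)" "Up \<notin> set (replicate (2 * k + 1 - a) Rt)"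
      by auto
    from append_Cons_eq_iff[OF this, THEN iffD1, OF eq] have "q = replicate a Rt"
      by (elim conjE) (rule sym)
    with i j p show "i < a \<and> j = 1"
      by (simp add: count_list_replicate)
  next
    assume ij: "i < a \<and> j = 1"
    have "dyck_path k a = (Up # replicate a Rt) @ Up # replicate (2 * k + 1 - a) Rt"
      by (simp add: dyck_path_def)
    moreover have "count_list (Up # replicate a Rt) Up = j"
      "i < count_list (Up # replicate a Rt) Rt"
      using ij by (simp_all add: count_list_replicate)
    ultimately show "(i, j) \<in> above_path (dyck_path k a)"
      unfolding above_path_def by blast
  qed
  then show ?thesis by auto
qed

lemma bij_betw_dyck_path: "bij_betw (dyck_path k) {..k} (Dyck (2 * k + 3))"
proof (rule bij_betw_imageI)
  show "inj_on (dyck_path k) {..k}"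
    by (rule inj_on_inverseI[where g = "\<lambda>P. card (above_path P)"])
      (simp add: above_path_dyck_path card_cartesian_product)
  show "dyck_path k ` {..k} = Dyck (2 * k + 3)"
    by (auto simp: dyck_path_in_Dyck elim: Dyck_cases)
qed

text \<open>In row 0 no box fits above the diagonal; in row 1 the condition
  \<open>2 * (i + 1) \<le> 2 * k + 1\<close> means \<open>i < k\<close>, and the first
  \<open>a\<close> boxes lie above the path.\<close>

lemma dyck_area_dyck_path: "dyck_area (2 * k + 3) (dyck_path k a) = k - a"
proof -
  have "{(i, j). i < 2 * k + 3 - 2 \<and> j < 2 \<and> (i, j) \<notin> above_path (dyck_path k a)
      \<and> 2 * (i + 1) \<le> (2 * k + 3 - 2) * j} = {a..<k} \<times> {1}"
    by (auto simp: above_path_dyck_path less_2_cases_iff)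
  then show ?thesis
    unfolding dyck_area_def by (simp add: card_cartesian_product)
qed

text \<open>All boxes above the path are in the upper row, so legs vanish and arms are at most
  \<open>k\<close>, less than half of \<open>2 * k + 1\<close>; hence every such box counts.\<close>

lemma dyck_dinv_dyck_path:
  assumes "a \<le> k"
  shows "dyck_dinv (2 * k + 3) (dyck_path k a) = a"
proof -
  let ?P = "dyck_path k a"
  have leg: "leg ?P b = 0" and arm: "arm ?P b \<le> k" if "b \<in> above_path ?P" for b
  proof -
    obtain i where b: "b = (i, 1)" and i: "i < a"
      using \<open>b \<in> above_path ?P\<close> by (auto simp: above_path_dyck_path)
    show "leg ?P b = 0"
      by (auto simp: b above_path_dyck_path)
    have "{i'. i < i' \<and> (i', 1) \<in> above_path ?P} = {i<..<a}"
      by (auto simp: above_path_dyck_path)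
    then show "arm ?P b \<le> k"
      using assms by (simp add: b)
  qed
  have "real (arm ?P b) / (real (leg ?P b) + 1) < (real (2 * k + 3) - 2) / 2 \<and>
       (leg ?P b = 0 \<or> (real (2 * k + 3) - 2) / 2 < (real (arm ?P b) + 1) / real (leg ?P b))"
    if "b \<in> above_path ?P" for b
    using leg[OF that] arm[OF that] by simp
  then have "dyck_dinv (2 * k + 3) ?P = card (above_path ?P)"
    unfolding dyck_dinv_def by (intro arg_cong[where f = card]) blast
  then show ?thesis
    by (simp add: above_path_dyck_path card_cartesian_product)
qed

section \<open>The bijections\<close>

theorem theorem7p7:
  fixes n :: nat
  assumes "n \<ge> 3" and "odd n"
  shows "(\<exists>\<Phi>. bij_betw \<Phi> (Deo_max n) (Dyck n) \<and>
            (\<forall>D\<in>Deo_max n. dyck_area n (\<Phi> D) = deo_area D \<and> dyck_dinv n (\<Phi> D) = deo_dinv D)) \<and>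
         bij_betw (rot n) (Deo_max n) (Deo_max n) \<and>
         (\<forall>D\<in>Deo_max n. (deo_area D, deo_dinv D) = (deo_dinv (rot n D), deo_area (rot n D)))"
proof -
  have "even (n - 3)" using assms by simp
  then obtain k where "n - 3 = 2 * k" by (rule evenE)
  with assms(1) have n: "n = 2 * k + 3" by simp
  \<comment> \<open>Fillings and paths are matched through the parameter \<open>a\<close>, which is
    the dinv on both sides, with \<open>k - a\<close> the area.\<close>
  define \<Phi> where "\<Phi> = dyck_path k \<circ> the_inv_into {..k} (deogram k)"
  have \<Phi>: "\<Phi> (deogram k a) = dyck_path k a" if "a \<le> k" for a
    using that bij_betw_imp_inj_on[OF bij_betw_deogram] by (simp add: \<Phi>_def the_inv_into_f_f)
  have "bij_betw \<Phi> (Deo_max n) (Dyck n)"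
    unfolding \<Phi>_def n
    by (rule bij_betw_trans[OF bij_betw_the_inv_into[OF bij_betw_deogram] bij_betw_dyck_path])
  moreover have "dyck_area n (\<Phi> D) = deo_area D \<and> dyck_dinv n (\<Phi> D) = deo_dinv D"
    if "D \<in> Deo_max n" for D
    using that unfolding n
    by (elim Deo_max_cases)
      (simp add: \<Phi> dyck_area_dyck_path dyck_dinv_dyck_path deo_area_deogram deo_dinv_deogram)
  moreover have "bij_betw (rot n) (Deo_max n) (Deo_max n)"
  \<comment> \<open>The rotation replaces \<open>a\<close> by \<open>k - a\<close>, so it is its own
    inverse.\<close>
  proof (rule bij_betw_byWitness[where f' = "rot n"])
    have "rot n D \<in> Deo_max n \<and> rot n (rot n D) = D" if "D \<in> Deo_max n" for D
      using that unfolding n by (elim Deo_max_cases) (simp add: rot_deogram deogram_in_Deo_max)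
    then show "\<forall>D\<in>Deo_max n. rot n (rot n D) = D" "\<forall>D\<in>Deo_max n. rot n (rot n D) = D"
      "rot n ` Deo_max n \<subseteq> Deo_max n" "rot n ` Deo_max n \<subseteq> Deo_max n"
      by auto
  qed
  moreover have "(deo_area D, deo_dinv D) = (deo_dinv (rot n D), deo_area (rot n D))"
    if "D \<in> Deo_max n" for D
    using that unfolding n
    by (elim Deo_max_cases) (simp add: rot_deogram deo_area_deogram deo_dinv_deogram)
  ultimately show ?thesis by blast
qed

end
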